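(* Let $1\le n\le 4$ and let $\lambda_1\ge\lambda_2\ge\dots\ge\lambda_n$ be real numbers. Then there exists an $n\times n$ nonnegative bisymmetric matrix with eigenvalues (counted with multiplicity) $\lambda_1,\lambda_2,\dots,\lambda_n$ if and only if $\lambda_1\ge|\lambda_n|$ and $\sum_{i=1}^n\lambda_i\ge 0$.
   Context: All matrices are real. A square matrix $Q$ is bisymmetric if $Q^T=Q$ and $JQJ=Q$, where $J$ is the reverse identity matrix (ones on the anti-diagonal, zeros elsewhere). A matrix is nonnegative if all its entries are $\ge 0$. *)

theory Defs
  imports "Jordan_Normal_Form.Char_Poly"
begin

(* Indices are 0-based, so the anti-diagonal consists of the positions with i + j = n - 1. *)
definition reverse_id_mat :: "nat \<Rightarrow> real mat" where
  "reverse_id_mat n = mat n n (\<lambda>(i, j). if i + j + 1 = n then 1 else 0)"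

definition bisymmetric_mat :: "real mat \<Rightarrow> bool" where
  "bisymmetric_mat Q \<longleftrightarrow>
     square_mat Q \<and> transpose_mat Q = Q \<and>
     reverse_id_mat (dim_row Q) * Q * reverse_id_mat (dim_row Q) = Q"

(* Entrywise nonnegativity, not positive semidefiniteness. *)
definition nonneg_mat :: "real mat \<Rightarrow> bool" where
  "nonneg_mat Q \<longleftrightarrow> (\<forall>i < dim_row Q. \<forall>j < dim_col Q. Q $$ (i, j) \<ge> 0)"

(* The family (lam i), i in {1..n}, lists all eigenvalues with algebraic multiplicity: the
   (monic) characteristic polynomial is the product of the factors X - lam i.  In particular
   the n x n matrix has no further eigenvalues, real or complex. *)
definition has_eigenvalues :: "real mat \<Rightarrow> nat \<Rightarrow> (nat \<Rightarrow> real) \<Rightarrow> bool" where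
  "has_eigenvalues Q n lam \<longleftrightarrow> char_poly Q = (\<Prod>i = 1..n. [:- lam i, 1:])"

end

theory Submission
  imports Defs "Jordan_Normal_Form.Schur_Decomposition"
begin

text \<open>
  Necessity: the matrix is similar to a triangular one, so the trace of its \<open>k\<close>-th power, which is
  nonnegative, equals the \<open>k\<close>-th power sum of the eigenvalues.  For \<open>k = 1\<close> this is the condition on
  the sum, and for large odd \<open>k\<close> it would fail if \<open>-\<lambda>\<^sub>n > \<lambda>\<^sub>1\<close>.

  Sufficiency: a bisymmetric matrix splits into its actions on symmetric and on skew-symmetric
  vectors.  For \<open>n = 3, 4\<close> we let \<open>\<lambda>\<^sub>1, \<lambda>\<^sub>2\<close> come from the symmetric part and the other eigenvalues
  from a diagonal skew-symmetric part; the diagonal of the symmetric part is chosen to dominate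
  them in absolute value.
\<close>

section \<open>Necessity: traces of matrix powers and power sums of the eigenvalues\<close>

definition mat_trace :: "'a::comm_monoid_add mat \<Rightarrow> 'a" where
  "mat_trace A = (\<Sum>i<dim_row A. A $$ (i, i))"

lemma mat_trace_mult_commute:
  fixes A B :: "'a::comm_semiring_0 mat"
  assumes "A \<in> carrier_mat n m" and "B \<in> carrier_mat m n"
  shows "mat_trace (A * B) = mat_trace (B * A)"
proof -
  have "mat_trace (A * B) = (\<Sum>i<n. \<Sum>j<m. A $$ (i, j) * B $$ (j, i))"
    using assms by (auto simp: mat_trace_def scalar_prod_def lessThan_atLeast0 intro!: sum.cong)
  also have "\<dots> = (\<Sum>j<m. \<Sum>i<n. A $$ (i, j) * B $$ (j, i))"
    by (rule sum.swap)
  also have "\<dots> = mat_trace (B * A)"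
    using assms
    by (auto simp: mat_trace_def scalar_prod_def lessThan_atLeast0 mult.commute intro!: sum.cong)
  finally show ?thesis .
qed

lemma mat_trace_similar:
  fixes A B :: "'a::comm_ring_1 mat"
  assumes "similar_mat_wit A B P Q"
  shows "mat_trace A = mat_trace B"
proof -
  define n where "n = dim_row A"
  note w = similar_mat_witD[OF n_def assms]
  have "mat_trace A = mat_trace (P * (B * Q))"
    using w by (simp add: assoc_mult_mat[of P n n B n Q n])
  also have "\<dots> = mat_trace (B * Q * P)"
    using w by (intro mat_trace_mult_commute[of _ n n]) auto
  also have "B * Q * P = B"
    using w by (simp add: assoc_mult_mat[of B n n Q n P n])
  finally show ?thesis .
qed

lemma upper_triangular_mult:
  fixes A B :: "'a::semiring_0 mat"
  assumes A: "A \<in> carrier_mat n n" "upper_triangular A"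
    and B: "B \<in> carrier_mat n n" "upper_triangular B"
  shows "upper_triangular (A * B)"
    and "i < n \<Longrightarrow> (A * B) $$ (i, i) = A $$ (i, i) * B $$ (i, i)"
proof -
  have entry: "(A * B) $$ (i, j) = (\<Sum>k<n. A $$ (i, k) * B $$ (k, j))" if "i < n" "j < n" for i j
    using A B that by (auto simp: scalar_prod_def lessThan_atLeast0)
  \<comment> \<open>Only indices \<open>k\<close> with i \<le> k \<le> j contribute to entry (i, j):
    none below the diagonal, just k = i on it.\<close>
  have zero: "A $$ (i, k) * B $$ (k, j) = 0" if "i < n" "k < n" "k < i \<or> j < k" for i j k
    using that upper_triangularD[OF A(2), of k i] upper_triangularD[OF B(2), of j k] A B by auto
  show "upper_triangular (A * B)"
  proof (rule upper_triangularI)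
    fix i j assume ij: "j < i" "i < dim_row (A * B)"
    then have "(A * B) $$ (i, j) = (\<Sum>k<n. A $$ (i, k) * B $$ (k, j))"
      using A by (intro entry) auto
    also have "\<dots> = 0"
      using ij A by (intro sum.neutral ballI zero) auto
    finally show "(A * B) $$ (i, j) = 0" .
  qed
  assume i: "i < n"
  have "(A * B) $$ (i, i) = (\<Sum>k<n. A $$ (i, k) * B $$ (k, i))"
    using i by (intro entry)
  also have "\<dots> = (\<Sum>k\<in>{i}. A $$ (i, k) * B $$ (k, i))"
    using i by (intro sum.mono_neutral_right ballI zero) auto
  finally show "(A * B) $$ (i, i) = A $$ (i, i) * B $$ (i, i)"
    by simp
qed

lemma upper_triangular_pow:
  fixes A :: "'a::comm_semiring_1 mat"
  assumes A: "A \<in> carrier_mat n n" "upper_triangular A"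
  shows "upper_triangular (A ^\<^sub>m k) \<and> (\<forall>i<n. (A ^\<^sub>m k) $$ (i, i) = A $$ (i, i) ^ k)"
proof (induction k)
  case 0
  then show ?case using A by auto
next
  case (Suc k)
  have "A ^\<^sub>m k \<in> carrier_mat n n"
    using A by simp
  with Suc upper_triangular_mult[OF _ _ A, of "A ^\<^sub>m k"] show ?case
    by (simp add: mult.commute)
qed

text \<open>Since the characteristic polynomial splits, Schur decomposition gives a similar
  triangular matrix with diagonal \<open>es\<close>. Similarity passes to powers, and powers of a
  triangular matrix have the powers of its diagonal entries on the diagonal.\<close>

lemma mat_trace_pow_eq_power_sum:
  fixes A :: "'a::conjugatable_ordered_field mat"
  assumes A: "A \<in> carrier_mat n n"
    and cp: "char_poly A = (\<Prod>e \<leftarrow> es. [:- e, 1:])"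
  shows "mat_trace (A ^\<^sub>m k) = (\<Sum>e \<leftarrow> es. e ^ k)"
proof -
  obtain B P Q where "schur_decomposition A es = (B, P, Q)"
    by (metis prod_cases3)
  with schur_decomposition[OF A cp] have w: "similar_mat_wit A B P Q"
    and ut: "upper_triangular B" and diag: "diag_mat B = es"
    by auto
  have B: "B \<in> carrier_mat n n"
    using similar_mat_witD2[OF A w] by simp
  have "mat_trace (A ^\<^sub>m k) = mat_trace (B ^\<^sub>m k)"
    by (rule mat_trace_similar, rule similar_mat_wit_pow[OF w])
  also have "\<dots> = (\<Sum>i<n. B $$ (i, i) ^ k)"
    using upper_triangular_pow[OF B ut, of k] B by (simp add: mat_trace_def)
  also have "\<dots> = (\<Sum>e \<leftarrow> diag_mat B. e ^ k)"
    using B by (simp add: diag_mat_def comp_def interv_sum_list_conv_sum_set_nat lessThan_atLeast0)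
  finally show ?thesis
    by (simp add: diag)
qed

lemma nonneg_mat_pow:
  assumes A: "A \<in> carrier_mat n n" "nonneg_mat A"
  shows "nonneg_mat (A ^\<^sub>m k)"
proof (induction k)
  case 0
  then show ?case by (simp add: nonneg_mat_def)
next
  case (Suc k)
  have "A ^\<^sub>m k \<in> carrier_mat n n"
    using A by simp
  with Suc A show ?case
    by (auto simp: nonneg_mat_def scalar_prod_def intro!: sum_nonneg)
qed

lemma power_sum_nonneg:
  assumes A: "A \<in> carrier_mat n n" "nonneg_mat A" and ev: "has_eigenvalues A n lam"
  shows "0 \<le> (\<Sum>i = 1..n. lam i ^ k)"
proof -
  have "char_poly A = (\<Prod>e \<leftarrow> map lam [1..<Suc n]. [:- e, 1:])"
    using ev unfolding has_eigenvalues_def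
    by (simp add: comp_def prod.distinct_set_conv_list[symmetric] atLeastLessThanSuc_atLeastAtMost
        del: upt_Suc)
  from mat_trace_pow_eq_power_sum[OF A(1) this, of k]
  have "mat_trace (A ^\<^sub>m k) = (\<Sum>i = 1..n. lam i ^ k)"
    by (simp add: comp_def interv_sum_list_conv_sum_set_nat atLeastLessThanSuc_atLeastAtMost
        del: upt_Suc)
  moreover have "0 \<le> mat_trace (A ^\<^sub>m k)"
    using nonneg_mat_pow[OF A, of k] A by (auto simp: mat_trace_def nonneg_mat_def intro!: sum_nonneg)
  ultimately show ?thesis
    by simp
qed

text \<open>If \<open>- lam n\<close> exceeded \<open>lam 1\<close>, the negative term
  \<open>lam n ^ k\<close> with \<open>k\<close> odd would eventually outweigh the other n - 1
  terms, each at most \<open>lam 1 ^ k\<close>.\<close>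

lemma abs_last_le_first_if_power_sums_nonneg:
  fixes lam :: "nat \<Rightarrow> real"
  assumes n: "1 \<le> n"
    and anti: "\<And>i j. 1 \<le> i \<Longrightarrow> i \<le> j \<Longrightarrow> j \<le> n \<Longrightarrow> lam j \<le> lam i"
    and sums: "\<And>k. 0 \<le> (\<Sum>i = 1..n. lam i ^ k)"
  shows "\<bar>lam n\<bar> \<le> lam 1"
proof (rule ccontr)
  assume "\<not> \<bar>lam n\<bar> \<le> lam 1"
  with anti[of 1 n] n have r: "lam 1 < - lam n"
    by linarith
  \<comment> \<open>Otherwise every \<open>lam i\<close> is negative, and so is the first power
    sum.\<close>
  have "0 \<le> lam 1"
  proof (rule ccontr)
    assume "\<not> 0 \<le> lam 1"
    with anti[of 1] have "(\<Sum>i = 1..n. lam i ^ 1) < 0"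
      using n by (intro sum_strict_mono[where g = "\<lambda>_. 0", simplified]) force+
    with sums[of 1] show False
      by simp
  qed
  \<comment> \<open>Odd powers are monotone on all of the reals, so negative \<open>lam i\<close>
    need no separate treatment.\<close>
  have bound: "(- lam n) ^ k \<le> real n * lam 1 ^ k" if "odd k" for k
  proof -
    have split: "{1..n} = insert n {1..<n}"
      using n by auto
    have "0 \<le> (\<Sum>i = 1..n. lam i ^ k)"
      by (rule sums)
    also have "\<dots> = lam n ^ k + (\<Sum>i = 1..<n. lam i ^ k)"
      unfolding split by simp
    also have "(\<Sum>i = 1..<n. lam i ^ k) \<le> real (card {1..<n}) * lam 1 ^ k"
      using anti that by (intro sum_bounded_above power_mono_odd) auto
    also have "\<dots> \<le> real n * lam 1 ^ k"
      using \<open>0 \<le> lam 1\<close> by (intro mult_right_mono) auto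
    finally show ?thesis
      using that by (simp add: power_minus_odd)
  qed
  show False
  proof (cases "lam 1 = 0")
    case True
    with bound[of 1] r show False by simp
  next
    case False
    with \<open>0 \<le> lam 1\<close> have pos: "0 < lam 1" by simp
    define q where "q = (- lam n) / lam 1"
    have q: "1 < q"
      unfolding q_def using r pos by (subst less_divide_eq_1_pos) auto
    obtain m where m: "real n < q ^ m"
      using real_arch_pow[OF q] by blast
    \<comment> \<open>\<open>bound\<close> covers odd exponents only, so \<open>m\<close> is
      replaced by a larger odd number.\<close>
    have "q ^ (2 * m + 1) \<le> real n"
      using bound[of "2 * m + 1"] pos by (simp add: q_def power_divide divide_simps)
    moreover have "q ^ m \<le> q ^ (2 * m + 1)"
      using q by (intro power_increasing) auto
    ultimately show False
      using m by linarith
  qed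
qed

section \<open>Sufficiency: determinants and characteristic polynomials of orders 2 to 4\<close>

lemma det_2:
  fixes A :: "'a::comm_ring_1 mat"
  assumes A: "A \<in> carrier_mat 2 2"
  shows "det A = A $$ (0, 0) * A $$ (1, 1) - A $$ (0, 1) * A $$ (1, 0)"
  using A
  by (subst laplace_expansion_row[OF A, of 0])
    (auto simp: cofactor_def mat_delete_def det_single numeral_2_eq_2)

lemma det_3:
  fixes A :: "'a::comm_ring_1 mat"
  assumes A: "A \<in> carrier_mat 3 3"
  shows "det A =
    A $$ (0, 0) * (A $$ (1, 1) * A $$ (2, 2) - A $$ (1, 2) * A $$ (2, 1)) -
    A $$ (0, 1) * (A $$ (1, 0) * A $$ (2, 2) - A $$ (1, 2) * A $$ (2, 0)) +
    A $$ (0, 2) * (A $$ (1, 0) * A $$ (2, 1) - A $$ (1, 1) * A $$ (2, 0))"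
proof -
  have *: "mat_delete A 0 j \<in> carrier_mat 2 2" for j
    using mat_delete_carrier[OF A] by simp
  show ?thesis
    using A
    by (subst laplace_expansion_row[OF A, of 0])
      (auto simp: cofactor_def det_2[OF *], auto simp: mat_delete_def eval_nat_numeral algebra_simps)
qed

text \<open>\<open>m i j k\<close> is the minor on rows 1, 2, 3 and columns \<open>i\<close>,
  \<open>j\<close>, \<open>k\<close> in Laplace expansion along row 0.\<close>

lemma det_4:
  fixes A :: "'a::comm_ring_1 mat"
  assumes A: "A \<in> carrier_mat 4 4"
  defines "m \<equiv> \<lambda>i j k. A $$ (1, i) * (A $$ (2, j) * A $$ (3, k) - A $$ (2, k) * A $$ (3, j)) -
    A $$ (1, j) * (A $$ (2, i) * A $$ (3, k) - A $$ (2, k) * A $$ (3, i)) +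
    A $$ (1, k) * (A $$ (2, i) * A $$ (3, j) - A $$ (2, j) * A $$ (3, i))"
  shows "det A = A $$ (0, 0) * m 1 2 3 - A $$ (0, 1) * m 0 2 3 + A $$ (0, 2) * m 0 1 3
    - A $$ (0, 3) * m 0 1 2"
proof -
  have *: "mat_delete A 0 j \<in> carrier_mat 3 3" for j
    using mat_delete_carrier[OF A] by simp
  show ?thesis
    using A
    by (subst laplace_expansion_row[OF A, of 0])
      (auto simp: cofactor_def det_3[OF *] m_def, auto simp: mat_delete_def eval_nat_numeral algebra_simps)
qed

lemma char_poly_bisymmetric_2:
  fixes a b :: "'a::comm_ring_1"
  shows "char_poly (mat_of_rows_list 2 [[a, b], [b, a]]) = [:- (a + b), 1:] * [:- (a - b), 1:]"
  unfolding char_poly_def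
  by (subst det_2)
    (auto simp: char_poly_matrix_def mat_of_rows_list_def eval_nat_numeral algebra_simps)

text \<open>On symmetric vectors (x, y, x) the matrix acts as [[a + c, b], [2b, e]], which gives the
  quadratic factor; (1, 0, -1) is an eigenvector for a - c.\<close>

lemma char_poly_bisymmetric_3:
  fixes a b c e :: "'a::comm_ring_1"
  shows "char_poly (mat_of_rows_list 3 [[a, b, c], [b, e, b], [c, b, a]]) =
    [:(a + c) * e - 2 * b\<^sup>2, - (a + c + e), 1:] * [:- (a - c), 1:]"
  unfolding char_poly_def
  by (subst det_3)
    (auto simp: char_poly_matrix_def mat_of_rows_list_def eval_nat_numeral algebra_simps)

text \<open>The factors belong to the blocks [[a + d, b + c], [b + c, e + f]] on vectors (x, y, y,
  x) and [[a - d, b - c], [b - c, e - f]] on vectors (x, y, -y, -x).\<close>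

lemma char_poly_bisymmetric_4:
  fixes a b c d e f :: "'a::comm_ring_1"
  shows "char_poly (mat_of_rows_list 4 [[a, b, c, d], [b, e, f, c], [c, f, e, b], [d, c, b, a]]) =
    [:(a + d) * (e + f) - (b + c)\<^sup>2, - (a + d + e + f), 1:] *
    [:(a - d) * (e - f) - (b - c)\<^sup>2, - (a - d + e - f), 1:]"
  unfolding char_poly_def
  by (subst det_4)
    (auto simp: char_poly_matrix_def mat_of_rows_list_def eval_nat_numeral algebra_simps)

section \<open>Sufficiency: bisymmetric matrices with prescribed eigenvalues\<close>

lemma bisymmetric_matI:
  assumes Q: "Q \<in> carrier_mat n n"
    and sym: "\<And>i j. i < n \<Longrightarrow> j < n \<Longrightarrow> Q $$ (j, i) = Q $$ (i, j)"
    and refl: "\<And>i j. i < n \<Longrightarrow> j < n \<Longrightarrow> Q $$ (n - 1 - i, n - 1 - j) = Q $$ (i, j)"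
  shows "bisymmetric_mat Q"
proof -
  let ?J = "reverse_id_mat n"
  have J: "?J \<in> carrier_mat n n"
    by (simp add: reverse_id_mat_def)
  \<comment> \<open>Row \<open>i\<close> of \<open>?J\<close> has its only 1 in column n - 1 - i, so
    multiplying by \<open>?J\<close> reverses rows from the left and columns from the right.\<close>
  have left: "(?J * A) $$ (i, j) = A $$ (n - 1 - i, j)"
    if "A \<in> carrier_mat n n" "i < n" "j < n" for A i j
  proof -
    have "(?J * A) $$ (i, j) = (\<Sum>k = 0..<n. ?J $$ (i, k) * A $$ (k, j))"
      using that J by (auto simp: scalar_prod_def)
    also have "\<dots> = (\<Sum>k = 0..<n. if k = n - 1 - i then A $$ (k, j) else 0)"
      using that by (intro sum.cong) (auto simp: reverse_id_mat_def)
    finally show ?thesis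
      using that by simp
  qed
  have right: "(A * ?J) $$ (i, j) = A $$ (i, n - 1 - j)"
    if "A \<in> carrier_mat n n" "i < n" "j < n" for A i j
  proof -
    have "(A * ?J) $$ (i, j) = (\<Sum>k = 0..<n. A $$ (i, k) * ?J $$ (k, j))"
      using that J by (auto simp: scalar_prod_def)
    also have "\<dots> = (\<Sum>k = 0..<n. if k = n - 1 - j then A $$ (i, k) else 0)"
      using that by (intro sum.cong) (auto simp: reverse_id_mat_def)
    finally show ?thesis
      using that by simp
  qed
  have "?J * Q * ?J = Q"
  proof (rule eq_matI)
    fix i j assume "i < dim_row Q" "j < dim_col Q"
    then have ij: "i < n" "j < n"
      using Q by auto
    have "(?J * Q * ?J) $$ (i, j) = (?J * Q) $$ (i, n - 1 - j)"
      using ij J Q by (intro right) auto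
    also have "\<dots> = Q $$ (n - 1 - i, n - 1 - j)"
      using ij Q by (intro left) auto
    finally show "(?J * Q * ?J) $$ (i, j) = Q $$ (i, j)"
      using refl ij by simp
  qed (use J Q in auto)
  moreover have "transpose_mat Q = Q"
    using Q sym by (intro eq_matI) auto
  ultimately show ?thesis
    using Q by (simp add: bisymmetric_mat_def)
qed

lemma exists_bisymmetric_2:
  fixes lam :: "nat \<Rightarrow> real"
  assumes "lam 2 \<le> lam 1" "0 \<le> lam 1 + lam 2"
  shows "\<exists>Q \<in> carrier_mat 2 2. nonneg_mat Q \<and> bisymmetric_mat Q \<and> has_eigenvalues Q 2 lam"
proof -
  \<comment> \<open>Solution of a + b = \<open>lam 1\<close>, a - b = \<open>lam 2\<close>; the two
    assumptions say that both are nonnegative.\<close>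
  define a b where "a = (lam 1 + lam 2) / 2" and "b = (lam 1 - lam 2) / 2"
  let ?Q = "mat_of_rows_list 2 [[a, b], [b, a]]"
  have Q: "?Q \<in> carrier_mat 2 2"
    by (intro carrier_matI) (simp_all add: mat_of_rows_list_def)
  have "0 \<le> a" "0 \<le> b"
    using assms by (auto simp: a_def b_def)
  then have "nonneg_mat ?Q"
    by (auto simp: nonneg_mat_def mat_of_rows_list_def eval_nat_numeral less_Suc_eq)
  moreover have "bisymmetric_mat ?Q"
    by (rule bisymmetric_matI[OF Q])
      (auto simp: mat_of_rows_list_def eval_nat_numeral less_Suc_eq)
  moreover have "has_eigenvalues ?Q 2 lam"
    unfolding has_eigenvalues_def char_poly_bisymmetric_2
    by (simp add: a_def b_def eval_nat_numeral field_simps)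
  ultimately show ?thesis
    using Q by blast
qed

lemma exists_bisymmetric_3:
  fixes lam :: "nat \<Rightarrow> real"
  assumes ord: "lam 2 \<le> lam 1" "lam 3 \<le> lam 2"
    and dom: "\<bar>lam 3\<bar> \<le> lam 1" and sum: "0 \<le> lam 1 + lam 2 + lam 3"
  shows "\<exists>Q \<in> carrier_mat 3 3. nonneg_mat Q \<and> bisymmetric_mat Q \<and> has_eigenvalues Q 3 lam"
proof -
  \<comment> \<open>\<open>p\<close> and \<open>e\<close> are the diagonal of the symmetric block,
    with sum \<open>lam 1 + lam 2\<close>. To dominate \<open>\<bar>lam 3\<bar>\<close>,
    \<open>p\<close> is the largest value with p \<le> \<open>lam 1\<close> and e \<ge> 0.\<close>
  define p where "p = lam 1 + min (lam 2) 0"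
  \<comment> \<open>\<open>a\<close> and \<open>c\<close> solve a + c = p, a - c =
    \<open>lam 3\<close>. The block must have determinant \<open>lam 1 * lam 2\<close>, so 2 b^2 =
    \<open>p * e - lam 1 * lam 2\<close>, which factors as under the root.\<close>
  define a b c e where "a = (p + lam 3) / 2" and "b = sqrt ((lam 1 - p) * (p - lam 2) / 2)"
    and "c = (p - lam 3) / 2" and "e = lam 1 + lam 2 - p"
  let ?Q = "mat_of_rows_list 3 [[a, b, c], [b, e, b], [c, b, a]]"
  have Q: "?Q \<in> carrier_mat 3 3"
    by (intro carrier_matI) (simp_all add: mat_of_rows_list_def)
  have p: "\<bar>lam 3\<bar> \<le> p" "lam 2 \<le> p" "p \<le> lam 1" "p \<le> lam 1 + lam 2"
    using assms by (auto simp: p_def)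
  have b: "b\<^sup>2 = (lam 1 - p) * (p - lam 2) / 2" "0 \<le> b"
    using p by (auto simp: b_def)
  have "0 \<le> a" "0 \<le> c" "0 \<le> e"
    using p by (auto simp: a_def c_def e_def)
  with b have "nonneg_mat ?Q"
    by (auto simp: nonneg_mat_def mat_of_rows_list_def eval_nat_numeral less_Suc_eq)
  moreover have "bisymmetric_mat ?Q"
    by (rule bisymmetric_matI[OF Q])
      (auto simp: mat_of_rows_list_def eval_nat_numeral less_Suc_eq)
  moreover have "has_eigenvalues ?Q 3 lam"
  proof -
    have ac: "a + c = p" "a - c = lam 3"
      by (auto simp: a_def c_def field_simps)
    have "[:(a + c) * e - 2 * b\<^sup>2, - (a + c + e), 1:] = [:- lam 1, 1:] * [:- lam 2, 1:]"
      unfolding b(1) ac by (simp add: e_def field_simps)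
    moreover have "{1..3} = {1, 2, 3 :: nat}"
      by auto
    ultimately show ?thesis
      unfolding has_eigenvalues_def char_poly_bisymmetric_3 ac(2)
      by (simp add: mult.assoc del: mult_pCons_left mult_pCons_right One_nat_def)
  qed
  ultimately show ?thesis
    using Q by blast
qed

lemma exists_bisymmetric_4:
  fixes lam :: "nat \<Rightarrow> real"
  assumes ord: "lam 2 \<le> lam 1" "lam 3 \<le> lam 2" "lam 4 \<le> lam 3"
    and dom: "\<bar>lam 4\<bar> \<le> lam 1" and sum: "0 \<le> lam 1 + lam 2 + lam 3 + lam 4"
  shows "\<exists>Q \<in> carrier_mat 4 4. nonneg_mat Q \<and> bisymmetric_mat Q \<and> has_eigenvalues Q 4 lam"
proof -
  \<comment> \<open>\<open>p\<close> and \<open>r\<close> are the diagonal of the symmetric block.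
    As \<open>lam 3 \<le> lam 2\<close>, this is the least \<open>r\<close> with
    \<open>lam 2 \<le> r\<close> and \<open>\<bar>lam 3\<bar> \<le> r\<close>, leaving the largest
    \<open>p\<close> to dominate \<open>\<bar>lam 4\<bar>\<close>.\<close>
  define r where "r = max (lam 2) (- lam 3)"
  define p where "p = lam 1 + lam 2 - r"
  \<comment> \<open>Taking c = b makes the skew block diagonal with entries a - d =
    \<open>lam 4\<close> and e - f = \<open>lam 3\<close>. The choice of \<open>b\<close> gives the
    symmetric block determinant \<open>lam 1 * lam 2\<close>.\<close>
  define a b d e f where "a = (p + lam 4) / 2" and "b = sqrt ((lam 1 - r) * (r - lam 2)) / 2"
    and "d = (p - lam 4) / 2" and "e = (r + lam 3) / 2" and "f = (r - lam 3) / 2"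
  let ?Q = "mat_of_rows_list 4 [[a, b, b, d], [b, e, f, b], [b, f, e, b], [d, b, b, a]]"
  have Q: "?Q \<in> carrier_mat 4 4"
    by (intro carrier_matI) (simp_all add: mat_of_rows_list_def)
  have r: "\<bar>lam 3\<bar> \<le> r" "lam 2 \<le> r" "r \<le> lam 1" and p: "\<bar>lam 4\<bar> \<le> p"
    using assms by (auto simp: r_def p_def)
  have b: "(b + b)\<^sup>2 = (lam 1 - r) * (r - lam 2)" "0 \<le> b"
    using r by (auto simp: b_def)
  have "0 \<le> a" "0 \<le> d" "0 \<le> e" "0 \<le> f"
    using p r by (auto simp: a_def d_def e_def f_def)
  with b have "nonneg_mat ?Q"
    by (auto simp: nonneg_mat_def mat_of_rows_list_def eval_nat_numeral less_Suc_eq)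
  moreover have "bisymmetric_mat ?Q"
    by (rule bisymmetric_matI[OF Q])
      (auto simp: mat_of_rows_list_def eval_nat_numeral less_Suc_eq)
  moreover have "has_eigenvalues ?Q 4 lam"
  proof -
    have ad: "a + d = p" "a - d = lam 4" and ef: "e + f = r" "e - f = lam 3"
      by (auto simp: a_def d_def e_def f_def field_simps)
    have "[:(a + d) * (e + f) - (b + b)\<^sup>2, - (a + d + e + f), 1:] = [:- lam 1, 1:] * [:- lam 2, 1:]"
      unfolding b(1) add.assoc[of _ e f] ad ef by (simp add: p_def field_simps)
    moreover have "[:(a - d) * (e - f) - (b - b)\<^sup>2, - (a - d + e - f), 1:]
        = [:- lam 3, 1:] * [:- lam 4, 1:]"
      unfolding add_diff_eq[symmetric] ad ef by simp
    moreover have "{1..4} = {1, 2, 3, 4 :: nat}"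
      by auto
    ultimately show ?thesis
      unfolding has_eigenvalues_def char_poly_bisymmetric_4
      by (simp add: mult.assoc del: mult_pCons_left mult_pCons_right One_nat_def)
  qed
  ultimately show ?thesis
    using Q by blast
qed

theorem theorem2p5:
  fixes n :: nat and lam :: "nat \<Rightarrow> real"
  assumes "1 \<le> n" and "n \<le> 4"
    and "\<And>i j. 1 \<le> i \<Longrightarrow> i \<le> j \<Longrightarrow> j \<le> n \<Longrightarrow> lam j \<le> lam i"
  shows "(\<exists>Q \<in> carrier_mat n n. nonneg_mat Q \<and> bisymmetric_mat Q \<and> has_eigenvalues Q n lam)
    \<longleftrightarrow> (lam 1 \<ge> \<bar>lam n\<bar> \<and> (\<Sum>i = 1..n. lam i) \<ge> 0)"
proof
  assume "\<exists>Q \<in> carrier_mat n n. nonneg_mat Q \<and> bisymmetric_mat Q \<and> has_eigenvalues Q n lam"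
  then have sums: "0 \<le> (\<Sum>i = 1..n. lam i ^ k)" for k
    using power_sum_nonneg by blast
  show "lam 1 \<ge> \<bar>lam n\<bar> \<and> (\<Sum>i = 1..n. lam i) \<ge> 0"
    using abs_last_le_first_if_power_sums_nonneg[OF assms(1,3) sums] sums[of 1] by simp
next
  assume *: "lam 1 \<ge> \<bar>lam n\<bar> \<and> (\<Sum>i = 1..n. lam i) \<ge> 0"
  have sets: "{1..2} = {1, 2 :: nat}" "{1..3} = {1, 2, 3 :: nat}" "{1..4} = {1, 2, 3, 4 :: nat}"
    by auto
  consider "n = 1" | "n = 2" | "n = 3" | "n = 4"
    using assms(1,2) by linarith
  then show "\<exists>Q \<in> carrier_mat n n. nonneg_mat Q \<and> bisymmetric_mat Q \<and> has_eigenvalues Q n lam"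
  proof cases
    case 1
    let ?Q = "mat 1 1 (\<lambda>_. lam 1)"
    have Q: "?Q \<in> carrier_mat 1 1"
      by simp
    \<comment> \<open>For n = 1 the condition \<open>\<bar>lam 1\<bar> \<le> lam 1\<close> amounts
      to \<open>0 \<le> lam 1\<close>.\<close>
    have "nonneg_mat ?Q"
      using * 1 by (simp add: nonneg_mat_def)
    moreover have "bisymmetric_mat ?Q"
      by (rule bisymmetric_matI[OF Q]) auto
    moreover have "has_eigenvalues ?Q 1 lam"
      by (simp add: has_eigenvalues_def char_poly_def det_single char_poly_matrix_def)
    ultimately show ?thesis
      using Q 1 by blast
  next
    case 2
    then show ?thesis
      using exists_bisymmetric_2[of lam] assms(3)[of 1 2] * by (simp add: sets del: One_nat_def)
  next
    case 3
    then show ?thesis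
      using exists_bisymmetric_3[of lam] assms(3)[of 1 2] assms(3)[of 2 3] *
      by (simp add: sets del: One_nat_def)
  next
    case 4
    then show ?thesis
      using exists_bisymmetric_4[of lam] assms(3)[of 1 2] assms(3)[of 2 3] assms(3)[of 3 4] *
      by (simp add: sets del: One_nat_def)
  qed
qed

end
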